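(* For every integer $n\ge 2$ let $(G^2_n,\boldsymbol c^2_n)$ be the EWMCP instance and $\mathscr C^2_n$ the coloring of $G^2_n$, of cardinality $n$, defined in the context. Then $$\frac{\mathrm{UB}_3(G^2_n,\boldsymbol c^2_n,n)}{\mathrm{UB}_1(G^2_n,\boldsymbol c^2_n,\mathscr C^2_n)}\to+\infty\quad\text{as } n\to+\infty .$$
   Context: An instance of the Edge-Weighted Maximum Clique Problem (EWMCP) is a pair $(G,\boldsymbol c)$ where $G=(V,E)$ is a finite simple undirected graph and $\boldsymbol c=(c_e)_{e\in E}$ is a vector of nonnegative integer edge-weights. For $u\in V$, $\delta(u)\subseteq E$ is the set of edges incident to $u$. A clique is a set of pairwise adjacent vertices. A coloring $\mathscr C$ of the vertices of $G$ is a partition of $V$ into disjoint non-empty independent sets (sets of pairwise non-adjacent vertices). First upper bound. $\mathrm{UB}_1(G,\boldsymbol c,\mathscr C)$ is the optimal value of the linear program, in real variables $\pi_I$ ($I\in\mathscr C$) and $\varrho_{eu},\varrho_{ev}$ (for each edge $e=\{u,v\}\in E$), $$\min \sum_{I\in\mathscr C}\pi_I$$ subject to $\varrho_{eu}+\varrho_{ev}=c_e$ for every $e=\{u,v\}\in E$; $\pi_I\ge\sum_{e\in\delta(u)}\varrho_{eu}$ for every $I\in\mathscr C$ and $u\in I$; and $\pi_I\ge0$, $\varrho_{eu}\ge0$, $\varrho_{ev}\ge0$ for all $I\in\mathscr C$ and all $e=\{u,v\}\in E$. Third upper bound. Let $k$ be an integer with $1\le k\le|V|$ that is an upper bound on the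 cardinality of every clique of $G$. For $u\in V$ and an integer $t\ge0$, $\delta_t(u)\subseteq\delta(u)$ denotes any set of the $\min\{t,|\delta(u)|\}$ heaviest edges incident to $u$. Set $\eta_u:=\frac12\sum_{e\in\delta_{k-1}(u)}c_e$ for $u\in V$, and order the vertices as $\varphi(1),\dots,\varphi(|V|)$ with $\eta_{\varphi(1)}\ge\eta_{\varphi(2)}\ge\dots\ge\eta_{\varphi(|V|)}$ (ties broken arbitrarily). Then $$\mathrm{UB}_3(G,\boldsymbol c,k):=\sum_{j=1}^{k}\eta_{\varphi(j)}.$$ The instances. For every integer $n\ge2$, the vertex set of $G^2_n$ is the disjoint union of a set $C_0$ of $n$ vertices and, for each $u\in C_0$, a set $C_u$ of $n-1$ vertices (the sets $C_0$ and $C_u$, $u\in C_0$, are pairwise disjoint). The edges are exactly those making $C_0$ a clique and $C_u\cup\{u\}$ a clique for every $u\in C_0$. Edges $\{u,v\}$ with $u\in C_0$ and $v\in C_u$ have weight $1$; all other edges have weight $0$. These weights define $\boldsymbol c^2_n$. The coloring. $\mathscr C^2_n=\{I_u:u\in C_0\}$ is a partition of the vertex set into $n$ independent sets, where each $I_u$ consists of the vertex $u$ together with exactly one vertex of $C_v$ for every $v\in C_0$, $v\ne u$, chosen so that each vertex of $C_v$ lies in exactly one of the sets $I_u$ with $u\ne v$. *)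

theory Defs
  imports Complex_Main "HOL-Library.Disjoint_Sets"
begin

section \<open>Graphs, cliques and colorings\<close>

record 'a ugraph =
  verts :: "'a set"
  edges :: "'a set set"

definition simple_graph :: "'a ugraph \<Rightarrow> bool" where
  "simple_graph G \<longleftrightarrow> finite (verts G) \<and>
     (\<forall>e\<in>edges G. \<exists>u v. e = {u, v} \<and> u \<noteq> v \<and> u \<in> verts G \<and> v \<in> verts G)"

definition incident :: "'a ugraph \<Rightarrow> 'a \<Rightarrow> 'a set set" where
  "incident G u = {e \<in> edges G. u \<in> e}"

definition is_clique :: "'a ugraph \<Rightarrow> 'a set \<Rightarrow> bool" where
  "is_clique G K \<longleftrightarrow> K \<subseteq> verts G \<and> (\<forall>u\<in>K. \<forall>v\<in>K. u \<noteq> v \<longrightarrow> {u, v} \<in> edges G)"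

definition is_independent :: "'a ugraph \<Rightarrow> 'a set \<Rightarrow> bool" where
  "is_independent G S \<longleftrightarrow> S \<subseteq> verts G \<and> (\<forall>u\<in>S. \<forall>v\<in>S. {u, v} \<notin> edges G)"

definition is_coloring :: "'a ugraph \<Rightarrow> 'a set set \<Rightarrow> bool" where
  "is_coloring G \<C> \<longleftrightarrow> partition_on (verts G) \<C> \<and> (\<forall>I\<in>\<C>. is_independent G I)"


section \<open>The first upper bound\<close>

text \<open>
  Edge weights are functions \<open>c\<close> of type \<open>'a set \<Rightarrow> nat\<close>; only their values on \<open>edges G\<close> matter.
  The variable \<open>\<rho> e u\<close> is the share of the weight of the edge \<open>e\<close> assigned to its end \<open>u\<close>.
\<close>

definition UB1_feasible ::
  "'a ugraph \<Rightarrow> ('a set \<Rightarrow> nat) \<Rightarrow> 'a set set \<Rightarrow> ('a set \<Rightarrow> real) \<Rightarrow> ('a set \<Rightarrow> 'a \<Rightarrow> real) \<Rightarrow> bool" where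
  "UB1_feasible G c \<C> \<pi> \<rho> \<longleftrightarrow>
     (\<forall>u v. {u, v} \<in> edges G \<longrightarrow> \<rho> {u, v} u + \<rho> {u, v} v = real (c {u, v})) \<and>
     (\<forall>I\<in>\<C>. \<forall>u\<in>I. \<pi> I \<ge> (\<Sum>e\<in>incident G u. \<rho> e u)) \<and>
     (\<forall>I\<in>\<C>. \<pi> I \<ge> 0) \<and>
     (\<forall>e\<in>edges G. \<forall>u\<in>e. \<rho> e u \<ge> 0)"

definition UB1_values :: "'a ugraph \<Rightarrow> ('a set \<Rightarrow> nat) \<Rightarrow> 'a set set \<Rightarrow> real set" where
  "UB1_values G c \<C> = {\<Sum>I\<in>\<C>. \<pi> I | \<pi> \<rho>. UB1_feasible G c \<C> \<pi> \<rho>}"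

definition UB1 :: "'a ugraph \<Rightarrow> ('a set \<Rightarrow> nat) \<Rightarrow> 'a set set \<Rightarrow> real" where
  "UB1 G c \<C> = Inf (UB1_values G c \<C>)"

text \<open>The linear program is feasible and bounded, so the infimum is its optimal value.\<close>

lemma UB1_values_bdd_below: "bdd_below (UB1_values G c \<C>)"
  by (rule bdd_belowI[of _ 0]) (auto simp: UB1_values_def UB1_feasible_def intro: sum_nonneg)

lemma simple_graph_finite_edges:
  assumes "simple_graph G"
  shows "finite (edges G)"
proof (rule finite_subset)
  show "edges G \<subseteq> Pow (verts G)"
    using assms unfolding simple_graph_def by fastforce
  show "finite (Pow (verts G))"
    using assms by (simp add: simple_graph_def)
qed

lemma UB1_values_nonempty:
  assumes "simple_graph G"
  shows "UB1_values G c \<C> \<noteq> {}"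
proof -
  have fin: "finite (edges G)"
    using assms by (rule simple_graph_finite_edges)
  have "(\<Sum>e\<in>incident G u. real (c e) / 2) \<le> (\<Sum>e\<in>edges G. real (c e) / 2)" for u
    by (rule sum_mono2) (auto simp: incident_def fin)
  then have "UB1_feasible G c \<C> (\<lambda>_. \<Sum>e\<in>edges G. real (c e) / 2) (\<lambda>e _. real (c e) / 2)"
    by (auto simp: UB1_feasible_def intro: sum_nonneg)
  then show ?thesis
    unfolding UB1_values_def by blast
qed


section \<open>The third upper bound\<close>

definition clique_bound :: "'a ugraph \<Rightarrow> nat \<Rightarrow> bool" where
  "clique_bound G k \<longleftrightarrow>
     1 \<le> k \<and> k \<le> card (verts G) \<and> (\<forall>K. is_clique G K \<longrightarrow> card K \<le> k)"

definition is_heaviest :: "'a ugraph \<Rightarrow> ('a set \<Rightarrow> nat) \<Rightarrow> nat \<Rightarrow> 'a \<Rightarrow> 'a set set \<Rightarrow> bool" where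
  "is_heaviest G c t u D \<longleftrightarrow>
     D \<subseteq> incident G u \<and> card D = min t (card (incident G u)) \<and>
     (\<forall>e\<in>D. \<forall>f\<in>incident G u - D. c f \<le> c e)"

definition eta :: "('a set \<Rightarrow> nat) \<Rightarrow> ('a \<Rightarrow> 'a set set) \<Rightarrow> 'a \<Rightarrow> real" where
  "eta c D u = 1/2 * (\<Sum>e\<in>D u. real (c e))"

definition is_order :: "'a set \<Rightarrow> ('a \<Rightarrow> real) \<Rightarrow> (nat \<Rightarrow> 'a) \<Rightarrow> bool" where
  "is_order V \<eta> \<phi> \<longleftrightarrow> bij_betw \<phi> {1..card V} V \<and>
     (\<forall>i\<in>{1..card V}. \<forall>j\<in>{1..card V}. i \<le> j \<longrightarrow> \<eta> (\<phi> i) \<ge> \<eta> (\<phi> j))"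

text \<open>
  \<open>UB3_value G c k x\<close>: some admissible choice of heaviest edge sets \<open>D u\<close> and of a vertex order
  \<open>\<phi>\<close> yields the value \<open>x\<close>. By \<open>UB3_value_ex1\<close> below the value does not depend on these choices.
\<close>

definition UB3_value :: "'a ugraph \<Rightarrow> ('a set \<Rightarrow> nat) \<Rightarrow> nat \<Rightarrow> real \<Rightarrow> bool" where
  "UB3_value G c k x \<longleftrightarrow> clique_bound G k \<and>
     (\<exists>D \<phi>. (\<forall>u\<in>verts G. is_heaviest G c (k - 1) u (D u)) \<and>
            is_order (verts G) (eta c D) \<phi> \<and>
            x = (\<Sum>j=1..k. eta c D (\<phi> j)))"

definition UB3 :: "'a ugraph \<Rightarrow> ('a set \<Rightarrow> nat) \<Rightarrow> nat \<Rightarrow> real" where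
  "UB3 G c k = (THE x. UB3_value G c k x)"

lemma top_sum_unique:
  fixes w :: "'b \<Rightarrow> real"
  assumes "finite S" "A \<subseteq> S" "B \<subseteq> S" "card A = card B"
    and A: "\<And>a b. a \<in> A \<Longrightarrow> b \<in> S - A \<Longrightarrow> w b \<le> w a"
    and B: "\<And>a b. a \<in> B \<Longrightarrow> b \<in> S - B \<Longrightarrow> w b \<le> w a"
  shows "sum w A = sum w B"
proof -
  have fin: "finite A" "finite B"
    using assms finite_subset by blast+
  have card: "card (A - B) = card (B - A)"
    using fin assms(4) by (metis card_Diff_subset_Int finite_Int Int_commute)
  have eq: "w a = w b" if "a \<in> A - B" "b \<in> B - A" for a b
    using A[of a b] B[of b a] that assms(2,3) by (intro antisym) auto
  have "sum w (A - B) = sum w (B - A)"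
  proof (cases "A - B = {}")
    case True
    then show ?thesis
      using card fin by (metis card_0_eq card.empty finite_Diff)
  next
    case False
    then obtain a where a: "a \<in> A - B" by blast
    have "B - A \<noteq> {}"
      using False card fin by (metis card_0_eq card.empty finite_Diff)
    then obtain b where b: "b \<in> B - A" by blast
    have "sum w (A - B) = (\<Sum>_\<in>A - B. w b)"
      using eq b by (intro sum.cong) auto
    also have "\<dots> = (\<Sum>_\<in>B - A. w a)"
      using card eq[OF a b] by simp
    also have "\<dots> = sum w (B - A)"
      using eq a by (intro sum.cong) auto
    finally show ?thesis .
  qed
  then show ?thesis
    using sum.Int_Diff[OF fin(1), of w B] sum.Int_Diff[OF fin(2), of w A] by (simp add: Int_commute)
qed

lemma is_order_exists:
  assumes "finite V"
  shows "\<exists>\<phi>. is_order V \<eta> \<phi>"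
proof -
  obtain ys where ys: "set ys = V" "distinct ys"
    using assms finite_distinct_list by blast
  define xs where "xs = sort_key (\<lambda>x. - \<eta> x) ys"
  have xs: "set xs = V" "distinct xs" "length xs = card V"
    using ys by (auto simp: xs_def distinct_card)
  have sorted: "sorted (map (\<lambda>x. - \<eta> x) xs)"
    by (simp add: xs_def)
  have "bij_betw (\<lambda>i. xs ! (i - 1)) {1..card V} V"
  proof (rule bij_betw_imageI)
    show "inj_on (\<lambda>i. xs ! (i - 1)) {1..card V}"
      using xs by (auto simp: inj_on_def nth_eq_iff_index_eq)
    have "(\<lambda>i. xs ! (i - 1)) ` {1..card V} = (!) xs ` {..<card V}"
    proof -
      have "(\<lambda>i. i - 1) ` {1..card V} = {..<card V}"
      proof
        show "{..<card V} \<subseteq> (\<lambda>i. i - 1) ` {1..card V}"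
        proof
          fix i assume "i \<in> {..<card V}"
          then show "i \<in> (\<lambda>i. i - 1) ` {1..card V}"
            by (intro image_eqI[of _ _ "Suc i"]) auto
        qed
      qed auto
      then show ?thesis
        by (metis image_image)
    qed
    then show "(\<lambda>i. xs ! (i - 1)) ` {1..card V} = V"
      using xs by (auto simp: set_conv_nth)
  qed
  moreover have "\<eta> (xs ! (i - 1)) \<ge> \<eta> (xs ! (j - 1))"
    if "i \<in> {1..card V}" "j \<in> {1..card V}" "i \<le> j" for i j
    using sorted_nth_mono[OF sorted, of "i - 1" "j - 1"] that xs(3) by simp
  ultimately show ?thesis
    unfolding is_order_def by blast
qed

lemma is_order_top:
  assumes ord: "is_order V \<eta> \<phi>" and k: "k \<le> card V"
  shows "\<phi> ` {1..k} \<subseteq> V" "card (\<phi> ` {1..k}) = k"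
    "a \<in> \<phi> ` {1..k} \<Longrightarrow> b \<in> V - \<phi> ` {1..k} \<Longrightarrow> \<eta> b \<le> \<eta> a"
    "sum \<eta> (\<phi> ` {1..k}) = (\<Sum>j=1..k. \<eta> (\<phi> j))"
proof -
  have bij: "bij_betw \<phi> {1..card V} V"
    and mono: "\<And>i j. i \<in> {1..card V} \<Longrightarrow> j \<in> {1..card V} \<Longrightarrow> i \<le> j \<Longrightarrow> \<eta> (\<phi> i) \<ge> \<eta> (\<phi> j)"
    using ord by (auto simp: is_order_def)
  have inj: "inj_on \<phi> {1..k}"
    using bij k by (auto simp: bij_betw_def intro: inj_on_subset)
  show "\<phi> ` {1..k} \<subseteq> V"
    using bij k by (auto simp: bij_betw_def)
  show "card (\<phi> ` {1..k}) = k"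
    using inj by (simp add: card_image)
  show "sum \<eta> (\<phi> ` {1..k}) = (\<Sum>j=1..k. \<eta> (\<phi> j))"
    using inj by (simp add: sum.reindex)
  assume a: "a \<in> \<phi> ` {1..k}" and b: "b \<in> V - \<phi> ` {1..k}"
  obtain i where i: "i \<in> {1..k}" "a = \<phi> i" using a by blast
  have "b \<in> \<phi> ` {1..card V}"
    using b bij by (simp add: bij_betw_def)
  then obtain j where j: "j \<in> {1..card V}" "b = \<phi> j" by blast
  have "j \<notin> {1..k}" using b j by blast
  then show "\<eta> b \<le> \<eta> a"
    using mono[of i j] i j k by auto
qed

lemma is_heaviest_exists:
  assumes "simple_graph G"
  shows "\<exists>D. is_heaviest G c t u D"
proof -
  have "finite (incident G u)"
    using simple_graph_finite_edges[OF assms] by (simp add: incident_def)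
  then obtain \<phi> where ord: "is_order (incident G u) (\<lambda>e. real (c e)) \<phi>"
    using is_order_exists by blast
  let ?t = "min t (card (incident G u))"
  note top = is_order_top[OF ord, of ?t]
  have "is_heaviest G c t u (\<phi> ` {1..?t})"
    unfolding is_heaviest_def
    using top(1,2) top(3) by (auto simp del: atLeastAtMost_iff)
  then show ?thesis by blast
qed

lemma is_heaviest_eta_unique:
  assumes "simple_graph G" "is_heaviest G c t u (D u)" "is_heaviest G c t u (D' u)"
  shows "eta c D u = eta c D' u"
proof -
  have "finite (incident G u)"
    using simple_graph_finite_edges[OF assms(1)] by (simp add: incident_def)
  then have "(\<Sum>e\<in>D u. real (c e)) = (\<Sum>e\<in>D' u. real (c e))"
    using assms(2,3) by (intro top_sum_unique[of "incident G u"]) (auto simp: is_heaviest_def)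
  then show ?thesis by (simp add: eta_def)
qed

lemma UB3_value_ex1:
  assumes G: "simple_graph G" and k: "clique_bound G k"
  shows "\<exists>!x. UB3_value G c k x"
proof -
  have fin: "finite (verts G)" and kV: "k \<le> card (verts G)"
    using G k by (auto simp: simple_graph_def clique_bound_def)
  obtain D where "\<And>u. is_heaviest G c (k - 1) u (D u)"
    using is_heaviest_exists[OF G] by metis
  moreover obtain \<phi> where "is_order (verts G) (eta c D) \<phi>"
    using is_order_exists[OF fin] by blast
  ultimately have ex: "\<exists>x. UB3_value G c k x"
    unfolding UB3_value_def using k by blast
  have "x = y" if "UB3_value G c k x" "UB3_value G c k y" for x y
  proof -
    obtain D \<phi> where 1: "\<forall>u\<in>verts G. is_heaviest G c (k - 1) u (D u)"
      "is_order (verts G) (eta c D) \<phi>" "x = (\<Sum>j=1..k. eta c D (\<phi> j))"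
      using \<open>UB3_value G c k x\<close> by (auto simp: UB3_value_def)
    obtain D' \<psi> where 2: "\<forall>u\<in>verts G. is_heaviest G c (k - 1) u (D' u)"
      "is_order (verts G) (eta c D') \<psi>" "y = (\<Sum>j=1..k. eta c D' (\<psi> j))"
      using \<open>UB3_value G c k y\<close> by (auto simp: UB3_value_def)
    have eq: "eta c D u = eta c D' u" if "u \<in> verts G" for u
      using is_heaviest_eta_unique[OF G] 1(1) 2(1) that by blast
    note A = is_order_top[OF 1(2) kV] and B = is_order_top[OF 2(2) kV]
    have "x = sum (eta c D) (\<phi> ` {1..k})"
      using A(4) 1(3) by simp
    also have "\<dots> = sum (eta c D) (\<psi> ` {1..k})"
    proof (rule top_sum_unique[OF fin A(1) B(1)])
      show "card (\<phi> ` {1..k}) = card (\<psi> ` {1..k})"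
        using A(2) B(2) by simp
      show "eta c D b \<le> eta c D a" if "a \<in> \<phi> ` {1..k}" "b \<in> verts G - \<phi> ` {1..k}" for a b
        using A(3) that .
      show "eta c D b \<le> eta c D a" if ab: "a \<in> \<psi> ` {1..k}" "b \<in> verts G - \<psi> ` {1..k}" for a b
      proof -
        have "a \<in> verts G" "b \<in> verts G" using ab B(1) by auto
        then show ?thesis using B(3)[OF ab] eq by simp
      qed
    qed
    also have "\<dots> = sum (eta c D') (\<psi> ` {1..k})"
      using B(1) eq by (intro sum.cong) auto
    also have "\<dots> = y"
      using B(4) 2(3) by simp
    finally show ?thesis .
  qed
  then show ?thesis using ex by blast
qed


section \<open>The instances and their colorings\<close>

text \<open>\<open>Center i\<close> is the \<open>i\<close>-th vertex \<open>u\<close> of \<open>C\<^sub>0\<close>, and \<open>Sat i j\<close> the \<open>j\<close>-th vertex of \<open>C\<^sub>u\<close>.\<close>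

datatype vertex = Center nat | Sat nat nat

definition C0 :: "nat \<Rightarrow> vertex set" where
  "C0 n = Center ` {..<n}"

definition Csat :: "nat \<Rightarrow> nat \<Rightarrow> vertex set" where
  "Csat n i = Sat i ` {..<n - 1}"

definition G2 :: "nat \<Rightarrow> vertex ugraph" where
  "G2 n = \<lparr> verts = C0 n \<union> (\<Union>i<n. Csat n i),
            edges = {{u, v} | u v. u \<noteq> v \<and> u \<in> C0 n \<and> v \<in> C0 n} \<union>
                    (\<Union>i<n. {{u, v} | u v. u \<noteq> v \<and> u \<in> insert (Center i) (Csat n i)
                                                \<and> v \<in> insert (Center i) (Csat n i)}) \<rparr>"

definition c2 :: "nat \<Rightarrow> vertex set \<Rightarrow> nat" where
  "c2 n e = (if \<exists>i<n. \<exists>v\<in>Csat n i. e = {Center i, v} then 1 else 0)"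

text \<open>
  \<open>s i j\<close> is the vertex of \<open>Csat n j\<close> chosen for the color class \<open>I i\<close> of \<open>Center i\<close>. The choice is
  not unique, so the colorings are described by a predicate; that they exist and are colorings with
  \<open>n\<close> classes is proved below.
\<close>

definition is_C2 :: "nat \<Rightarrow> vertex set set \<Rightarrow> bool" where
  "is_C2 n \<C> \<longleftrightarrow> (\<exists>I s. \<C> = I ` {..<n} \<and>
     (\<forall>i<n. \<forall>j<n. j \<noteq> i \<longrightarrow> s i j \<in> Csat n j) \<and>
     (\<forall>i<n. I i = insert (Center i) (s i ` ({..<n} - {i}))) \<and>
     (\<forall>j<n. \<forall>v\<in>Csat n j. \<exists>!i. i < n \<and> i \<noteq> j \<and> v \<in> I i))"

lemma simple_graph_G2: "simple_graph (G2 n)"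
  unfolding simple_graph_def
proof (intro conjI ballI)
  show "finite (verts (G2 n))"
    by (simp add: G2_def C0_def Csat_def)
  fix e assume "e \<in> edges (G2 n)"
  then show "\<exists>u v. e = {u, v} \<and> u \<noteq> v \<and> u \<in> verts (G2 n) \<and> v \<in> verts (G2 n)"
    unfolding G2_def C0_def by (simp del: insert_iff) blast
qed

lemma is_C2_exists: "\<exists>\<C>. is_C2 n \<C>"
proof -
  define s where "s i j = Sat j (if i < j then i else i - 1)" for i j
  define I where "I i = insert (Center i) (s i ` ({..<n} - {i}))" for i
  have "s i j \<in> Csat n j" if "i < n" "j < n" "j \<noteq> i" for i j
    using that by (auto simp: s_def Csat_def)
  moreover have "\<exists>!i. i < n \<and> i \<noteq> j \<and> v \<in> I i" if jn: "j < n" and v: "v \<in> Csat n j" for j v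
  proof -
    obtain m where m: "m < n - 1" "v = Sat j m"
      using v by (auto simp: Csat_def)
    have mem: "v \<in> I i \<longleftrightarrow> (if i < j then i = m else i = Suc m)" if "i \<noteq> j" for i
      using that m jn by (auto simp: I_def s_def)
    show ?thesis
      by (rule ex1I[of _ "if m < j then m else Suc m"]) (use mem m in \<open>auto split: if_splits\<close>)
  qed
  ultimately have "is_C2 n (I ` {..<n})"
    unfolding is_C2_def by (intro exI[of _ I] exI[of _ s]) (simp add: I_def)
  then show ?thesis by blast
qed

lemma G2_adj_Sat:
  assumes "{Sat i j, v} \<in> edges (G2 n)"
  shows "v = Center i \<or> v \<in> Csat n i"
  using assms by (auto simp: G2_def C0_def Csat_def doubleton_eq_iff)

lemma is_C2_coloring:
  assumes "is_C2 n \<C>"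
  shows "is_coloring (G2 n) \<C>" "card \<C> = n"
proof -
  obtain I s where H: "\<C> = I ` {..<n} \<and>
     (\<forall>i<n. \<forall>j<n. j \<noteq> i \<longrightarrow> s i j \<in> Csat n j) \<and>
     (\<forall>i<n. I i = insert (Center i) (s i ` ({..<n} - {i}))) \<and>
     (\<forall>j<n. \<forall>v\<in>Csat n j. \<exists>!i. i < n \<and> i \<noteq> j \<and> v \<in> I i)"
    using assms unfolding is_C2_def by (elim exE) (rule that)
  have C: "\<C> = I ` {..<n}"
    using H by (rule conjunct1)
  have s: "s i j \<in> Csat n j" if "i < n" "j < n" "j \<noteq> i" for i j
    using H that by simp
  have I: "I i = insert (Center i) (s i ` ({..<n} - {i}))" if "i < n" for i
    using H that by simp
  have ex1: "\<exists>!i. i < n \<and> i \<noteq> j \<and> v \<in> I i" if "j < n" "v \<in> Csat n j" for j v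
    using H that by (elim conjE) metis
  have center: "Center i \<in> I i' \<longleftrightarrow> i = i'" if "i' < n" for i i'
  proof -
    have "Center i \<noteq> s i' j" if "j < n" "j \<noteq> i'" for j
      using s[OF \<open>i' < n\<close> that] by (auto simp: Csat_def)
    then show ?thesis
      using I[OF that] by auto
  qed
  have sat: "\<exists>j<n. j \<noteq> i \<and> v = s i j \<and> v \<in> Csat n j" if "i < n" "v \<in> I i" "v \<noteq> Center i" for i v
    using that s by (auto simp: I)
  have cases: "(v = Center i) \<or> (\<exists>j m. j < n \<and> j \<noteq> i \<and> v = Sat j m \<and> s i j = v \<and> v \<in> Csat n j)"
    if "i < n" "v \<in> I i" for i v
    using sat[OF that] unfolding Csat_def by blast
  have inj: "inj_on I {..<n}"
    using center by (intro inj_onI) (metis lessThan_iff)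
  then show "card \<C> = n"
    by (simp add: C card_image)
  have indep: "is_independent (G2 n) (I i)" if i: "i < n" for i
    unfolding is_independent_def
  proof (intro conjI ballI)
    show "I i \<subseteq> verts (G2 n)"
    proof
      fix v assume "v \<in> I i"
      then show "v \<in> verts (G2 n)"
        using cases[OF i, of v] i by (auto simp: G2_def C0_def)
    qed
    fix u v assume uv: "u \<in> I i" "v \<in> I i"
    have ne: "u \<noteq> v" if "{u, v} \<in> edges (G2 n)"
      using simple_graph_G2[of n] that by (force simp: simple_graph_def doubleton_eq_iff)
    show "{u, v} \<notin> edges (G2 n)"
    proof
      assume e: "{u, v} \<in> edges (G2 n)"
      then have e': "{v, u} \<in> edges (G2 n)" by (simp add: insert_commute)
      have no_sat: False
        if "Sat j m = x" "s i j = x" "j \<noteq> i" "{x, y} \<in> edges (G2 n)" "x \<noteq> y" "y \<in> I i" for x y j m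
      proof -
        have "y = Center j \<or> y \<in> Csat n j"
          using G2_adj_Sat[of j m y n] that by simp
        then show False
          using cases[OF i \<open>y \<in> I i\<close>] that by (auto simp: Csat_def)
      qed
      show False
        using cases[OF i uv(1)] cases[OF i uv(2)]
      proof (elim disjE exE conjE)
        assume "u = Center i" "v = Center i"
        then show False using ne[OF e] by simp
      qed (use no_sat uv ne[OF e] e e' in metis)+
    qed
  qed
  have "\<Union>\<C> = verts (G2 n)"
  proof
    show "\<Union>\<C> \<subseteq> verts (G2 n)"
      using indep by (auto simp: C is_independent_def)
    show "verts (G2 n) \<subseteq> \<Union>\<C>"
    proof
      fix v assume "v \<in> verts (G2 n)"
      then consider i where "i < n" "v = Center i" | j where "j < n" "v \<in> Csat n j"
        by (auto simp: G2_def C0_def)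
      then show "v \<in> \<Union>\<C>"
      proof cases
        case 1
        then show ?thesis using center by (auto simp: C)
      next
        case 2
        then show ?thesis using ex1[of j v] by (auto simp: C)
      qed
    qed
  qed
  moreover have "disjoint \<C>"
  proof (rule disjointI)
    fix A B assume "A \<in> \<C>" "B \<in> \<C>" "A \<noteq> B"
    then obtain i i' where i: "i < n" "i' < n" "i \<noteq> i'" "A = I i" "B = I i'"
      by (auto simp: C)
    have False if v: "v \<in> I i" "v \<in> I i'" for v
    proof (cases v)
      case (Center j)
      then show ?thesis using v center i by metis
    next
      case (Sat j m)
      then have "j < n" "j \<noteq> i" "j \<noteq> i'" "v \<in> Csat n j"
        using cases[OF i(1) v(1)] cases[OF i(2) v(2)] by auto
      then show ?thesis using ex1[of j v] v i by blast
    qed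
    then show "A \<inter> B = {}" using i by blast
  qed
  moreover have "{} \<notin> \<C>"
    using I by (auto simp: C)
  ultimately show "is_coloring (G2 n) \<C>"
    using indep by (auto simp: is_coloring_def partition_on_def C)
qed

lemma clique_bound_G2:
  assumes "n \<ge> 2"
  shows "clique_bound (G2 n) n"
  unfolding clique_bound_def
proof (intro conjI allI impI)
  have cC: "card (C0 n) = n"
    by (simp add: C0_def card_image inj_on_def)
  have cS: "card (insert (Center i) (Csat n i)) \<le> n" for i
  proof -
    have "card (Csat n i) \<le> n - 1"
      unfolding Csat_def using card_image_le[of "{..<n - 1}" "Sat i"] by simp
    then show ?thesis
      using card_insert_le_m1[of n "Csat n i" "Center i"] assms by simp
  qed
  show "1 \<le> n" using assms by simp
  have "card (C0 n) \<le> card (verts (G2 n))"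
    by (rule card_mono) (auto simp: G2_def C0_def Csat_def)
  then show "n \<le> card (verts (G2 n))" by (simp add: cC)
  fix K assume K: "is_clique (G2 n) K"
  show "card K \<le> n"
  proof (cases "K \<subseteq> C0 n")
    case True
    then have "card K \<le> card (C0 n)"
      by (intro card_mono) (auto simp: C0_def)
    then show ?thesis by (simp add: cC)
  next
    case False
    then obtain i j where ij: "Sat i j \<in> K" "Sat i j \<in> Csat n i"
      using K by (fastforce simp: is_clique_def G2_def Csat_def)
    have "K \<subseteq> insert (Center i) (Csat n i)"
    proof
      fix v assume "v \<in> K"
      then show "v \<in> insert (Center i) (Csat n i)"
        using K ij G2_adj_Sat[of i j v n] by (cases "v = Sat i j") (auto simp: is_clique_def)
    qed
    then have "card K \<le> card (insert (Center i) (Csat n i))"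
      by (intro card_mono) (auto simp: Csat_def)
    then show ?thesis using cS[of i] by linarith
  qed
qed

end

theory Submission
  imports Defs
begin

text \<open>
  The weight-one edges of \<open>G2 n\<close> form \<open>n\<close> disjoint stars, each with a center in \<open>C0 n\<close> and
  \<open>n - 1\<close> satellites, and the two bounds account for these edges differently.

  The first bound may split the weight of an edge unevenly between its ends. Charging every edge
  to its satellite leaves each vertex with a load of at most \<open>1\<close>, so every one of the \<open>n\<close> color
  classes costs at most \<open>1\<close>, and the bound is at most \<open>n\<close> (lemma \<open>UB1_G2_le\<close>).

  The third bound gives half of the weight of an edge to either end. The centers, each of which
  sees \<open>n - 1\<close> edges of weight one, then have \<open>\<eta>\<close>-value \<open>(n - 1) / 2\<close>, the largest value that
  \<open>n - 1\<close> edges of weight at most one allow. Since there are \<open>n\<close> centers, they can serve as the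
  \<open>n\<close> vertices of largest \<open>\<eta>\<close>, and the bound equals \<open>n * (n - 1) / 2\<close> (lemma \<open>UB3_G2\<close>).

  The ratio is therefore at least \<open>(n - 1) / 2\<close>. As division by zero yields zero, this conclusion
  also needs the first bound to be positive, which holds because it is at least the weight of any
  single edge (lemma \<open>weight_le_UB1\<close>).
\<close>

section \<open>The first bound\<close>

text \<open>
  The ends of an edge lie in different color classes. The variables of these two classes together
  dominate the two shares of the edge, which add up to its weight.
\<close>

lemma weight_le_UB1:
  assumes G: "simple_graph G" and col: "is_coloring G \<C>" and e: "{u, v} \<in> edges G"
  shows "real (c {u, v}) \<le> UB1 G c \<C>"
  unfolding UB1_def
proof (rule cInf_greatest[OF UB1_values_nonempty[OF G]])
  fix x assume "x \<in> UB1_values G c \<C>"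
  then obtain \<pi> \<rho> where x: "x = (\<Sum>I\<in>\<C>. \<pi> I)" and feas: "UB1_feasible G c \<C> \<pi> \<rho>"
    by (auto simp: UB1_values_def)
  have part: "partition_on (verts G) \<C>" and indep: "\<And>I. I \<in> \<C> \<Longrightarrow> is_independent G I"
    using col by (auto simp: is_coloring_def)
  have "finite (verts G)"
    using G by (simp add: simple_graph_def)
  then have fin: "finite \<C>"
    using finite_elements part by blast
  have "u \<in> verts G" "v \<in> verts G"
    using G e by (fastforce simp: simple_graph_def doubleton_eq_iff)+
  then obtain I J where I: "I \<in> \<C>" "u \<in> I" and J: "J \<in> \<C>" "v \<in> J"
    using partition_onD1[OF part] by blast
  have "I \<noteq> J"
    using indep[OF I(1)] I(2) J(2) e by (auto simp: is_independent_def)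
  have share_le: "\<rho> {u, v} w \<le> \<pi> K" if "K \<in> \<C>" "w \<in> K" "w \<in> {u, v}" for w K
  proof -
    have "\<rho> {u, v} w \<le> (\<Sum>e\<in>incident G w. \<rho> e w)"
      by (rule member_le_sum)
        (use feas e that simple_graph_finite_edges[OF G] in
          \<open>auto simp: UB1_feasible_def incident_def\<close>)
    also have "\<dots> \<le> \<pi> K"
      using feas that by (auto simp: UB1_feasible_def)
    finally show ?thesis .
  qed
  have "real (c {u, v}) = \<rho> {u, v} u + \<rho> {u, v} v"
    using feas e by (auto simp: UB1_feasible_def)
  also have "\<dots> \<le> \<pi> I + \<pi> J"
    using share_le[OF I] share_le[OF J] by simp
  also have "\<dots> = (\<Sum>K\<in>{I, J}. \<pi> K)"
    using \<open>I \<noteq> J\<close> by simp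
  also have "\<dots> \<le> x"
    unfolding x by (rule sum_mono2) (use fin I J feas in \<open>auto simp: UB1_feasible_def\<close>)
  finally show "real (c {u, v}) \<le> x" .
qed

lemma star_edge_G2:
  assumes "i < n" "j < n - 1"
  shows "{Center i, Sat i j} \<in> edges (G2 n)" "c2 n {Center i, Sat i j} = 1"
proof -
  have "{Center i, Sat i j} \<in> {{u, v} |u v. u \<noteq> v \<and> u \<in> insert (Center i) (Csat n i)
      \<and> v \<in> insert (Center i) (Csat n i)}"
    using assms(2) by (intro CollectI exI[of _ "Center i"] exI[of _ "Sat i j"]) (auto simp: Csat_def)
  then show "{Center i, Sat i j} \<in> edges (G2 n)"
    using assms(1) unfolding G2_def ugraph.simps by blast
  show "c2 n {Center i, Sat i j} = 1"
    using assms by (auto simp: c2_def Csat_def)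
qed

lemma c2_le_1: "c2 n e \<le> 1"
  by (simp add: c2_def)

lemma c2_eq_0:
  assumes "Sat i j \<in> e" "e \<noteq> {Center i, Sat i j}"
  shows "c2 n e = 0"
  using assms by (auto simp: c2_def Csat_def)

lemma c2_centers: "c2 n {Center i, Center i'} = 0"
  by (auto simp: c2_def Csat_def doubleton_eq_iff)

lemma c2_satellites: "c2 n {Sat i j, Sat i' j'} = 0"
  by (auto simp: c2_def Csat_def doubleton_eq_iff)

text \<open>
  The feasible solution behind this estimate charges every edge to its satellite, with \<open>\<pi>\<close>
  constantly \<open>1\<close>; a satellite is an end of only one edge of nonzero weight.
\<close>

lemma UB1_G2_le:
  assumes "is_C2 n \<C>"
  shows "UB1 (G2 n) (c2 n) \<C> \<le> n"
proof -
  define \<rho> where "\<rho> e u = (case u of Center i \<Rightarrow> 0 | Sat i j \<Rightarrow> real (c2 n e))" for e u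
  have fin: "finite (incident (G2 n) u)" for u
    using simple_graph_finite_edges[OF simple_graph_G2] by (simp add: incident_def)
  have split: "\<rho> {u, v} u + \<rho> {u, v} v = real (c2 n {u, v})" for u v
    by (cases u; cases v) (simp_all add: \<rho>_def c2_centers c2_satellites)
  have load: "(\<Sum>e\<in>incident (G2 n) u. \<rho> e u) \<le> 1" for u
  proof (cases u)
    case (Center i)
    then show ?thesis by (simp add: \<rho>_def)
  next
    case (Sat i j)
    have "(\<Sum>e\<in>incident (G2 n) u. \<rho> e u)
        \<le> (\<Sum>e\<in>incident (G2 n) u. if e = {Center i, Sat i j} then 1 else 0)"
    proof (rule sum_mono)
      fix e assume "e \<in> incident (G2 n) u"
      then have "Sat i j \<in> e"
        using Sat by (simp add: incident_def)
      then show "\<rho> e u \<le> (if e = {Center i, Sat i j} then 1 else 0)"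
        using c2_le_1[of n e] c2_eq_0[of i j e n] Sat by (auto simp: \<rho>_def)
    qed
    also have "\<dots> \<le> 1"
      by (simp add: fin)
    finally show ?thesis .
  qed
  have "\<rho> e u \<ge> 0" for e u
    by (simp add: \<rho>_def split: vertex.split)
  with split load have "UB1_feasible (G2 n) (c2 n) \<C> (\<lambda>_. 1) \<rho>"
    by (simp add: UB1_feasible_def)
  then have "(\<Sum>I\<in>\<C>. 1) \<in> UB1_values (G2 n) (c2 n) \<C>"
    unfolding UB1_values_def by blast
  then have "UB1 (G2 n) (c2 n) \<C> \<le> (\<Sum>I\<in>\<C>. 1)"
    unfolding UB1_def by (rule cInf_lower[OF _ UB1_values_bdd_below])
  then show ?thesis
    using is_C2_coloring(2)[OF assms] by simp
qed

section \<open>The third bound\<close>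

lemma eta_le:
  assumes "\<And>e. c e \<le> 1" "is_heaviest G c t u (D u)"
  shows "eta c D u \<le> t / 2"
proof -
  have "(\<Sum>e\<in>D u. real (c e)) \<le> (\<Sum>e\<in>D u. 1)"
    by (rule sum_mono) (use assms(1) in simp)
  also have "\<dots> \<le> t"
    using assms(2) by (simp add: is_heaviest_def)
  finally show ?thesis by (simp add: eta_def)
qed

text \<open>
  The \<open>n - 1\<close> edges of the star at a center have the maximal weight \<open>1\<close>, so they are an admissible
  choice of heaviest edges.
\<close>

lemma eta_Center:
  assumes i: "i < n" and D: "is_heaviest (G2 n) (c2 n) (n - 1) (Center i) (D (Center i))"
  shows "eta (c2 n) D (Center i) = real (n - 1) / 2"
proof -
  define S where "S = (\<lambda>j. {Center i, Sat i j}) ` {..<n - 1}"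
  have fin: "finite (incident (G2 n) (Center i))"
    using simple_graph_finite_edges[OF simple_graph_G2] by (simp add: incident_def)
  have card: "card S = n - 1"
    by (auto simp: S_def card_image inj_on_def doubleton_eq_iff)
  have sub: "S \<subseteq> incident (G2 n) (Center i)"
    using star_edge_G2(1)[OF i] by (auto simp: S_def incident_def)
  have weight: "c2 n e = 1" if "e \<in> S" for e
    using that star_edge_G2(2)[OF i] by (auto simp: S_def)
  have "n - 1 \<le> card (incident (G2 n) (Center i))"
    using card_mono[OF fin sub] card by simp
  then have S: "is_heaviest (G2 n) (c2 n) (n - 1) (Center i) S"
    using sub card weight c2_le_1 by (auto simp: is_heaviest_def)
  have "eta (c2 n) D (Center i) = eta (c2 n) (\<lambda>_. S) (Center i)"
    by (rule is_heaviest_eta_unique[OF simple_graph_G2, where D = D and D' = "\<lambda>_. S", OF D S])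
  also have "\<dots> = real (n - 1) / 2"
    using weight card by (simp add: eta_def)
  finally show ?thesis .
qed

lemma UB3_G2:
  assumes "n \<ge> 2"
  shows "UB3 (G2 n) (c2 n) n = real n * real (n - 1) / 2"
proof -
  note bound = clique_bound_G2[OF assms]
  have fin: "finite (verts (G2 n))"
    using simple_graph_G2 by (simp add: simple_graph_def)
  have "UB3_value (G2 n) (c2 n) n (UB3 (G2 n) (c2 n) n)"
    unfolding UB3_def by (rule theI'[OF UB3_value_ex1[OF simple_graph_G2 bound]])
  then obtain D \<phi> where D: "\<And>u. u \<in> verts (G2 n) \<Longrightarrow> is_heaviest (G2 n) (c2 n) (n - 1) u (D u)"
    and ord: "is_order (verts (G2 n)) (eta (c2 n) D) \<phi>"
    and eq: "UB3 (G2 n) (c2 n) n = (\<Sum>j=1..n. eta (c2 n) D (\<phi> j))"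
    unfolding UB3_value_def by blast
  have "n \<le> card (verts (G2 n))"
    using bound by (simp add: clique_bound_def)
  note top = is_order_top[OF ord this]
  have sub: "C0 n \<subseteq> verts (G2 n)"
    by (auto simp: G2_def)
  have card: "card (C0 n) = n"
    by (simp add: C0_def card_image inj_on_def)
  have center: "eta (c2 n) D u = real (n - 1) / 2" if "u \<in> C0 n" for u
    using that eta_Center[of _ n D] D sub by (force simp: C0_def)
  have le: "eta (c2 n) D u \<le> real (n - 1) / 2" if "u \<in> verts (G2 n)" for u
    by (rule eta_le[where D = D, OF c2_le_1 D[OF that]])
  have "UB3 (G2 n) (c2 n) n = sum (eta (c2 n) D) (\<phi> ` {1..n})"
    using eq top(4) by simp
  \<comment> \<open>For \<open>n = 2\<close> satellites tie with centers, so \<open>\<phi>\<close> need not list the centers first.\<close>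
  also have "\<dots> = sum (eta (c2 n) D) (C0 n)"
  proof (rule top_sum_unique[OF fin top(1) sub _ top(3)])
    show "card (\<phi> ` {1..n}) = card (C0 n)"
      using top(2) card by simp
    show "eta (c2 n) D b \<le> eta (c2 n) D a" if "a \<in> C0 n" "b \<in> verts (G2 n) - C0 n" for a b
      using center[of a] le[of b] that by simp
  qed
  also have "\<dots> = (\<Sum>u\<in>C0 n. real (n - 1) / 2)"
    using center by (rule sum.cong[OF refl])
  also have "\<dots> = real n * real (n - 1) / 2"
    using card by simp
  finally show ?thesis .
qed

section \<open>Divergence of the ratio\<close>

theorem proposition8:
  fixes \<C> :: "nat \<Rightarrow> vertex set set"
  assumes "\<And>n. n \<ge> 2 \<Longrightarrow> is_C2 n (\<C> n)"
  shows "filterlim (\<lambda>n. UB3 (G2 n) (c2 n) n / UB1 (G2 n) (c2 n) (\<C> n)) at_top sequentially"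
proof (rule filterlim_at_top_mono)
  show "filterlim (\<lambda>n. real (n - 1) / 2) at_top sequentially"
  proof (rule filterlim_at_top_mono[OF _ eventually_sequentiallyI])
    show "filterlim (\<lambda>n. - (1/2) + real n * (1/2)) at_top sequentially"
      by (intro filterlim_tendsto_add_at_top[OF tendsto_const]
          filterlim_at_top_mult_tendsto_pos[OF tendsto_const] filterlim_real_sequentially) simp
    show "- (1/2) + real n * (1/2) \<le> real (n - 1) / 2" if "0 \<le> n" for n
      by (cases n) (simp_all add: field_simps)
  qed
  have "real (n - 1) / 2 \<le> UB3 (G2 n) (c2 n) n / UB1 (G2 n) (c2 n) (\<C> n)" if n: "n \<ge> 2" for n
  proof -
    let ?U = "UB1 (G2 n) (c2 n) (\<C> n)"
    note C2 = assms[OF n]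
    have "real (c2 n {Center 0, Sat 0 0}) \<le> ?U"
      by (rule weight_le_UB1[OF simple_graph_G2 is_C2_coloring(1)[OF C2] star_edge_G2(1)])
        (use n in auto)
    then have pos: "0 < ?U"
      using star_edge_G2(2)[of 0 n 0] n by simp
    have "real (n - 1) / 2 * ?U \<le> real (n - 1) / 2 * n"
      by (rule mult_left_mono[OF UB1_G2_le[OF C2]]) simp
    then show ?thesis
      using pos UB3_G2[OF n] by (simp add: pos_le_divide_eq mult.commute)
  qed
  then show "eventually (\<lambda>n. real (n - 1) / 2 \<le> UB3 (G2 n) (c2 n) n / UB1 (G2 n) (c2 n) (\<C> n))
      sequentially"
    by (rule eventually_sequentiallyI)
qed

end
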